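(* Let $A$ be the sequent $\big((z\lor\neg y)\land(\neg z\lor\neg y)\big)^R$ and $B$ the sequent $\big((x\land y)\lor(\neg x\land y)\big)^R$, where $x,y,z$ are distinct variables. Then the pair $(A,B)$ is inconsistent in orthologic, but it has no refutation-based interpolant. Consequently, refutation-based interpolants do not always exist in orthologic.
   Context: Formulas of (propositional) orthologic are built from variables, $0,1$, $\land,\lor,\neg$ ($\land,\lor$ commutative). An annotated formula is $\phi^L$ or $\phi^R$; a sequent is a set of at most two annotated formulas; $\Gamma,\Delta$ denote sets of zero or one annotated formula. The proof rules are: Hyp: $\phi^L,\phi^R$. Cut: from $\Gamma,\psi^R$ and $\psi^L,\Delta$ infer $\Gamma,\Delta$. Weaken: from $\Gamma$ infer $\Gamma,\Delta$. LeftAnd: from $\Gamma,\phi^L$ infer $\Gamma,(\phi\land\psi)^L$. RightAnd: from $\Gamma,\phi^R$ and $\Gamma,\psi^R$ infer $\Gamma,(\phi\land\psi)^R$. LeftOr: from $\Gamma,\phi^L$ and $\Gamma,\psi^L$ infer $\Gamma,(\phi\lor\psi)^L$. RightOr: from $\Gamma,\phi^R$ infer $\Gamma,(\phi\lor\psi)^R$. LeftNot: from $\Gamma,\phi^R$ infer $\Gamma,(\neg\phi)^L$. RightNot: from $\Gamma,\phi^L$ infer $\Gamma,(\neg\phi)^R$. A sequent can be deduced from a set of sequents (axioms) if it has a derivation using these rules in which the given sequents may additionally be used as leaves. A pair of sequents $(A,B)$ is inconsistent if the empty sequent can be deduced from $\{A,B\}$. A refutation-based interpolant of an inconsistent pair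 $(A,B)$ is a sequent $I$ such that $I$ can be deduced from $A$ alone, the pair $(I,B)$ is inconsistent, and the free variables of $I$ are among those common to $A$ and $B$. *)

theory Defs
  imports Main "HOL-Library.Uprod"
begin

(* Conj and Disj take unordered pairs, so that formulas are identified up to
   commutativity of conjunction and disjunction at every depth. *)
datatype (vars_form: 'v) form =
    Var 'v
  | Zero
  | One
  | Conj "'v form uprod"
  | Disj "'v form uprod"
  | Neg "'v form"

abbreviation And :: "'v form \<Rightarrow> 'v form \<Rightarrow> 'v form"  (infixr \<open>and\<^sub>o\<close> 65)
  where "\<phi> and\<^sub>o \<psi> \<equiv> Conj (Upair \<phi> \<psi>)"

abbreviation Or :: "'v form \<Rightarrow> 'v form \<Rightarrow> 'v form"  (infixr \<open>or\<^sub>o\<close> 60)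
  where "\<phi> or\<^sub>o \<psi> \<equiv> Disj (Upair \<phi> \<psi>)"

datatype (vars_annotated: 'v) annotated = Lft "'v form" | Rgt "'v form"

type_synonym 'v sequent = "'v annotated set"

definition is_sequent :: "'v sequent \<Rightarrow> bool"
  where "is_sequent S \<longleftrightarrow> finite S \<and> card S \<le> 2"

(* the range of the metavariables \<Gamma>, \<Delta> of the proof rules *)
definition at_most_one :: "'v sequent \<Rightarrow> bool"
  where "at_most_one \<Gamma> \<longleftrightarrow> finite \<Gamma> \<and> card \<Gamma> \<le> 1"

definition vars_sequent :: "'v sequent \<Rightarrow> 'v set"
  where "vars_sequent S = (\<Union>a\<in>S. vars_annotated a)"

(* Sequents are sets, so in every rule \<Gamma> may coincide with the active formula
   (contraction is implicit).  The single And/Or introduction rules act on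
   either operand because Upair is symmetric.  There are no rules for Zero and
   One. *)
inductive deducible :: "'v sequent set \<Rightarrow> 'v sequent \<Rightarrow> bool"  (infix \<open>\<turnstile>\<^sub>o\<close> 50)
  for Ax :: "'v sequent set"
where
  Axiom: "S \<in> Ax \<Longrightarrow> Ax \<turnstile>\<^sub>o S"
| Hyp: "Ax \<turnstile>\<^sub>o {Lft \<phi>, Rgt \<phi>}"
| Cut: "\<lbrakk>at_most_one \<Gamma>; at_most_one \<Delta>; Ax \<turnstile>\<^sub>o \<Gamma> \<union> {Rgt \<psi>}; Ax \<turnstile>\<^sub>o {Lft \<psi>} \<union> \<Delta>\<rbrakk>
    \<Longrightarrow> Ax \<turnstile>\<^sub>o \<Gamma> \<union> \<Delta>"
| Weaken: "\<lbrakk>at_most_one \<Gamma>; at_most_one \<Delta>; Ax \<turnstile>\<^sub>o \<Gamma>\<rbrakk> \<Longrightarrow> Ax \<turnstile>\<^sub>o \<Gamma> \<union> \<Delta>"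
| LeftAnd: "\<lbrakk>at_most_one \<Gamma>; Ax \<turnstile>\<^sub>o \<Gamma> \<union> {Lft \<phi>}\<rbrakk> \<Longrightarrow> Ax \<turnstile>\<^sub>o \<Gamma> \<union> {Lft (\<phi> and\<^sub>o \<psi>)}"
| RightAnd: "\<lbrakk>at_most_one \<Gamma>; Ax \<turnstile>\<^sub>o \<Gamma> \<union> {Rgt \<phi>}; Ax \<turnstile>\<^sub>o \<Gamma> \<union> {Rgt \<psi>}\<rbrakk>
    \<Longrightarrow> Ax \<turnstile>\<^sub>o \<Gamma> \<union> {Rgt (\<phi> and\<^sub>o \<psi>)}"
| LeftOr: "\<lbrakk>at_most_one \<Gamma>; Ax \<turnstile>\<^sub>o \<Gamma> \<union> {Lft \<phi>}; Ax \<turnstile>\<^sub>o \<Gamma> \<union> {Lft \<psi>}\<rbrakk>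
    \<Longrightarrow> Ax \<turnstile>\<^sub>o \<Gamma> \<union> {Lft (\<phi> or\<^sub>o \<psi>)}"
| RightOr: "\<lbrakk>at_most_one \<Gamma>; Ax \<turnstile>\<^sub>o \<Gamma> \<union> {Rgt \<phi>}\<rbrakk> \<Longrightarrow> Ax \<turnstile>\<^sub>o \<Gamma> \<union> {Rgt (\<phi> or\<^sub>o \<psi>)}"
| LeftNot: "\<lbrakk>at_most_one \<Gamma>; Ax \<turnstile>\<^sub>o \<Gamma> \<union> {Rgt \<phi>}\<rbrakk> \<Longrightarrow> Ax \<turnstile>\<^sub>o \<Gamma> \<union> {Lft (Neg \<phi>)}"
| RightNot: "\<lbrakk>at_most_one \<Gamma>; Ax \<turnstile>\<^sub>o \<Gamma> \<union> {Lft \<phi>}\<rbrakk> \<Longrightarrow> Ax \<turnstile>\<^sub>o \<Gamma> \<union> {Rgt (Neg \<phi>)}"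

definition inconsistent :: "'v sequent \<Rightarrow> 'v sequent \<Rightarrow> bool"
  where "inconsistent A B \<longleftrightarrow> {A, B} \<turnstile>\<^sub>o {}"

(* The notion is meant for inconsistent pairs (A, B); inconsistency of the pair
   is stated separately wherever the notion is used. *)
definition refutation_interpolant :: "'v sequent \<Rightarrow> 'v sequent \<Rightarrow> 'v sequent \<Rightarrow> bool"
  where "refutation_interpolant A B I \<longleftrightarrow>
    is_sequent I \<and> {A} \<turnstile>\<^sub>o I \<and> inconsistent I B \<and>
    vars_sequent I \<subseteq> vars_sequent A \<inter> vars_sequent B"

end

(* From B one deduces y, and then A gives both z and its negation.  For the second part, orthologic is
   sound for Goldblatt's orthoframe semantics.  The axiom A holds in the ortholattice MO2 when y and z
   are non-orthogonal atoms.  There the subalgebra generated by y is Boolean with four elements, so it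
   maps homomorphically onto the two-element algebra with y going to 1.  A would-be interpolant
   mentions only y, hence it survives this map; but B also holds classically once y is true, so the
   interpolant is consistent with B. *)
theory Submission
  imports Defs
begin

section \<open>Orthoframe semantics\<close>

definition perp :: "('w \<Rightarrow> 'w \<Rightarrow> bool) \<Rightarrow> 'w set \<Rightarrow> 'w set"
  where "perp r X = {w. \<forall>v\<in>X. r w v}"

text \<open>For symmetric irreflexive \<open>r\<close>, the sets fixed by double \<open>perp\<close>
  form an ortholattice. A union of fixed sets need not be fixed, so the join closes it by double
  \<open>perp\<close>.\<close>

primrec eval :: "('w \<Rightarrow> 'w \<Rightarrow> bool) \<Rightarrow> ('v \<Rightarrow> 'w set) \<Rightarrow> 'v form \<Rightarrow> 'w set"
  where
    "eval r V (Var v) = V v"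
  | "eval r V Zero = {}"
  | "eval r V One = UNIV"
  | "eval r V (Conj p) = \<Inter> (set_uprod (map_uprod (eval r V) p))"
  | "eval r V (Disj p) = perp r (perp r (\<Union> (set_uprod (map_uprod (eval r V) p))))"
  | "eval r V (Neg \<phi>) = perp r (eval r V \<phi>)"

primrec eval_annotated :: "('w \<Rightarrow> 'w \<Rightarrow> bool) \<Rightarrow> ('v \<Rightarrow> 'w set) \<Rightarrow> 'v annotated \<Rightarrow> 'w set"
  where
    "eval_annotated r V (Lft \<phi>) = perp r (eval r V \<phi>)"
  | "eval_annotated r V (Rgt \<phi>) = eval r V \<phi>"

(* The two members may coincide, which covers singletons: the orthocomplement of a lies below a only
   if a = 1.  Joins would be the wrong reading of a two-element sequent, since a \<or> b = 1 is weaker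
   than the complement of a lying below b. *)
definition holds :: "('w \<Rightarrow> 'w \<Rightarrow> bool) \<Rightarrow> ('v \<Rightarrow> 'w set) \<Rightarrow> 'v sequent \<Rightarrow> bool"
  where "holds r V S \<longleftrightarrow>
    (\<exists>a\<in>S. \<exists>b\<in>S. perp r (eval_annotated r V a) \<subseteq> eval_annotated r V b)"

lemma at_most_one_cases:
  assumes "at_most_one \<Gamma>"
  obtains "\<Gamma> = {}" | a where "\<Gamma> = {a}"
proof -
  have "\<forall>a\<in>\<Gamma>. \<forall>b\<in>\<Gamma>. a = b"
    using assms card_le_Suc0_iff_eq[of \<Gamma>] by (simp add: at_most_one_def)
  then show ?thesis
    using that by blast
qed

section \<open>Soundness in orthoframes\<close>

locale orthoframe =
  fixes r :: "'w \<Rightarrow> 'w \<Rightarrow> bool" and V :: "'v \<Rightarrow> 'w set"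
  assumes sym: "r u v \<Longrightarrow> r v u"
    and irrefl: "\<not> r u u"
    and regular: "perp r (perp r (V p)) = V p"
begin

lemma perp_antimono: "X \<subseteq> Y \<Longrightarrow> perp r Y \<subseteq> perp r X"
  by (auto simp: perp_def)

lemma perp_perp_superset: "X \<subseteq> perp r (perp r X)"
  using sym by (auto simp: perp_def)

lemma perp_perp_perp [simp]: "perp r (perp r (perp r X)) = perp r X"
  by (meson perp_antimono perp_perp_superset subset_antisym)

lemma perp_Un: "perp r (X \<union> Y) = perp r X \<inter> perp r Y"
  by (auto simp: perp_def)

lemma perp_UNIV [simp]: "perp r UNIV = {}"
  using irrefl by (auto simp: perp_def)

lemma perp_empty [simp]: "perp r {} = UNIV"
  by (auto simp: perp_def)

lemma perp_perp_eval [simp]: "perp r (perp r (eval r V \<phi>)) = eval r V \<phi>"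
proof (induction \<phi>)
  case (Conj p)
  \<comment> \<open>Double \<open>perp\<close> is monotone and fixes each conjunct, so the closure
    of the meet stays below every conjunct.\<close>
  have "perp r (perp r (\<Inter> (eval r V ` set_uprod p))) \<subseteq> eval r V \<psi>"
    if "\<psi> \<in> set_uprod p" for \<psi>
    using that Conj.IH perp_antimono by (metis INF_lower)
  then show ?case
    using perp_perp_superset by (auto simp: uprod.set_map)
qed (auto simp: regular)

lemma perp_perp_eval_annotated [simp]:
  "perp r (perp r (eval_annotated r V a)) = eval_annotated r V a"
  by (cases a) auto

lemma eval_And: "eval r V (\<phi> and\<^sub>o \<psi>) = eval r V \<phi> \<inter> eval r V \<psi>"
  by simp

lemma eval_Or: "eval r V (\<phi> or\<^sub>o \<psi>) = perp r (perp r (eval r V \<phi>) \<inter> perp r (eval r V \<psi>))"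
  by (simp add: perp_Un)

lemma perp_subset_swap:
  "perp r (eval_annotated r V a) \<subseteq> eval_annotated r V b \<Longrightarrow>
   perp r (eval_annotated r V b) \<subseteq> eval_annotated r V a"
  by (metis perp_antimono perp_perp_eval_annotated)

text \<open>Irreflexivity makes a set disjoint from its \<open>perp\<close>, so the inclusion forces
  that \<open>perp\<close> to be empty.\<close>

lemma perp_subset_self:
  "perp r (eval_annotated r V a) \<subseteq> eval_annotated r V a \<longleftrightarrow> eval_annotated r V a = UNIV"
proof
  assume *: "perp r (eval_annotated r V a) \<subseteq> eval_annotated r V a"
  have "perp r (eval_annotated r V a) = {}"
    using * irrefl by (auto simp: perp_def)
  then show "eval_annotated r V a = UNIV"
    by (metis perp_empty perp_perp_eval_annotated)
qed simp

lemma perp_eval_annotated_empty [simp]: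
  "perp r (eval_annotated r V a) = {} \<longleftrightarrow> eval_annotated r V a = UNIV"
  by (metis perp_UNIV perp_empty perp_perp_eval_annotated)

lemma holds_empty [simp]: "\<not> holds r V {}"
  by (simp add: holds_def)

lemma holds_singleton [simp]: "holds r V {a} \<longleftrightarrow> eval_annotated r V a = UNIV"
  by (simp add: holds_def perp_subset_self)

lemma holds_pair [simp]:
  "holds r V {a, b} \<longleftrightarrow> perp r (eval_annotated r V a) \<subseteq> eval_annotated r V b"
  using perp_subset_swap perp_subset_self by (auto simp: holds_def)

lemma holds_mono: "holds r V S \<Longrightarrow> S \<subseteq> T \<Longrightarrow> holds r V T"
  by (auto simp: holds_def)

text \<open>Turns each introduction rule into inclusions with a common left side. For empty \<Gamma>
  the intersection is \<open>UNIV\<close>, so \<open>b\<close> must be top.\<close>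

lemma holds_Un_singleton:
  "at_most_one \<Gamma> \<Longrightarrow> holds r V (\<Gamma> \<union> {b}) \<longleftrightarrow>
    (\<Inter>a\<in>\<Gamma>. perp r (eval_annotated r V a)) \<subseteq> eval_annotated r V b"
  using perp_subset_swap
  by (elim at_most_one_cases) (auto simp flip: insert_is_Un simp: top_unique)

theorem deducible_sound:
  assumes "Ax \<turnstile>\<^sub>o S" and "\<And>T. T \<in> Ax \<Longrightarrow> holds r V T"
  shows "holds r V S"
  using assms(1)
proof induction
  case (Axiom S)
  then show ?case by (rule assms(2))
next
  case (Hyp \<phi>)
  show ?case by simp
next
  case (Cut \<Gamma> \<Delta> \<psi>)
  \<comment> \<open>The complement of \<Gamma> lies below \<psi>, and \<psi> below \<Delta>; the
    inclusions compose. With both contexts empty, \<psi> would be both top and bottom.\<close>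
  show ?case
    using Cut.hyps(1,2) Cut.IH
    by (elim at_most_one_cases) auto
next
  case (Weaken \<Gamma> \<Delta>)
  then show ?case using holds_mono by blast
next
  case (LeftAnd \<Gamma> \<phi> \<psi>)
  have "perp r (eval r V \<phi>) \<subseteq> perp r (eval r V (\<phi> and\<^sub>o \<psi>))"
    by (rule perp_antimono) simp
  with LeftAnd show ?case
    by (auto simp only: holds_Un_singleton eval_annotated.simps)
next
  case (RightAnd \<Gamma> \<phi> \<psi>)
  then show ?case
    by (auto simp only: holds_Un_singleton eval_annotated.simps eval_And)
next
  case (LeftOr \<Gamma> \<phi> \<psi>)
  have "perp r (eval r V (\<phi> or\<^sub>o \<psi>)) = perp r (eval r V \<phi>) \<inter> perp r (eval r V \<psi>)"
    by (simp add: perp_Un[symmetric])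
  with LeftOr show ?case
    by (auto simp only: holds_Un_singleton eval_annotated.simps)
next
  case (RightOr \<Gamma> \<phi> \<psi>)
  have "eval r V \<phi> \<subseteq> eval r V (\<phi> or\<^sub>o \<psi>)"
    using perp_perp_superset[of "eval r V \<phi> \<union> eval r V \<psi>"] by simp
  with RightOr show ?case
    by (auto simp only: holds_Un_singleton eval_annotated.simps)
next
  case (LeftNot \<Gamma> \<phi>)
  then show ?case
    by (simp only: holds_Un_singleton eval_annotated.simps eval.simps perp_perp_eval)
next
  case (RightNot \<Gamma> \<phi>)
  then show ?case
    by (simp only: holds_Un_singleton eval_annotated.simps eval.simps)
qed

end

(* The orthoframe of MO2: its four points are the atoms, in two orthogonal pairs. *)
definition orth_MO2 :: "bool \<times> bool \<Rightarrow> bool \<times> bool \<Rightarrow> bool"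
  where "orth_MO2 u v \<longleftrightarrow> fst u = fst v \<and> snd u \<noteq> snd v"

definition val_MO2 :: "'v \<Rightarrow> 'v \<Rightarrow> (bool \<times> bool) set"
  where "val_MO2 y v = {(v = y, True)}"

text \<open>On one point, irreflexivity leaves only the empty relation; its fixed sets form the
  two-element Boolean algebra.\<close>

definition orth_unit :: "unit \<Rightarrow> unit \<Rightarrow> bool"
  where "orth_unit u v \<longleftrightarrow> False"

lemma perp_MO2_singleton: "perp orth_MO2 {(i, j)} = {(i, \<not> j)}"
  by (auto simp: perp_def orth_MO2_def)

text \<open>No point is orthogonal to two different points. Hence any two distinct atoms join to
  top.\<close>

lemma perp_MO2_two_atoms: "u \<noteq> v \<Longrightarrow> perp orth_MO2 {u, v} = {}"
  by (cases u; cases v) (auto simp: perp_def orth_MO2_def)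

interpretation MO2: orthoframe orth_MO2 "val_MO2 y" for y
  by unfold_locales (auto simp: orth_MO2_def val_MO2_def perp_MO2_singleton)

interpretation classical: orthoframe orth_unit "\<lambda>_. UNIV"
  by unfold_locales (auto simp: orth_unit_def perp_def)

section \<open>Collapse onto the two-element algebra\<close>

definition bool_subalgebra :: "(bool \<times> bool) set set"
  where "bool_subalgebra = {{}, {(True, True)}, {(True, False)}, UNIV}"

text \<open>Tests membership of the atom assigned to \<open>y\<close>. Outside
  \<open>bool_subalgebra\<close> complements are not preserved: both atoms of the other pair
  collapse to the empty set.\<close>

definition collapse :: "(bool \<times> bool) set \<Rightarrow> unit set"
  where "collapse X = {u. (True, True) \<in> X}"

lemma perp_bool_subalgebra:
  assumes "X \<in> bool_subalgebra"
  shows "perp orth_MO2 X \<in> bool_subalgebra"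
    and "collapse (perp orth_MO2 X) = perp orth_unit (collapse X)"
  using assms MO2.perp_UNIV MO2.perp_empty
  by (auto simp: bool_subalgebra_def collapse_def perp_MO2_singleton perp_def[of orth_unit]
      orth_unit_def)

lemma Int_bool_subalgebra:
  assumes "X \<in> bool_subalgebra" and "Y \<in> bool_subalgebra"
  shows "X \<inter> Y \<in> bool_subalgebra" and "collapse (X \<inter> Y) = collapse X \<inter> collapse Y"
  using assms by (auto simp: bool_subalgebra_def collapse_def)

text \<open>By \<open>eval_Or\<close>, joins reduce to complements and meets, which
  \<open>collapse\<close> preserves on the subalgebra.\<close>

lemma eval_bool_subalgebra:
  assumes "vars_form \<phi> \<subseteq> {y}"
  shows "eval orth_MO2 (val_MO2 y) \<phi> \<in> bool_subalgebra \<and>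
    collapse (eval orth_MO2 (val_MO2 y) \<phi>) = eval orth_unit (\<lambda>_. UNIV) \<phi>"
  using assms
proof (induction \<phi>)
  case (Conj p)
  obtain \<phi> \<psi> where p: "p = Upair \<phi> \<psi>" by (cases p) auto
  show ?case
    using Conj unfolding p MO2.eval_And classical.eval_And
    by (simp add: Int_bool_subalgebra)
next
  case (Disj p)
  obtain \<phi> \<psi> where p: "p = Upair \<phi> \<psi>" by (cases p) auto
  show ?case
    using Disj unfolding p MO2.eval_Or classical.eval_Or
    by (simp add: Int_bool_subalgebra perp_bool_subalgebra)
next
  case (Neg \<phi>)
  then show ?case by (simp add: perp_bool_subalgebra)
qed (auto simp: val_MO2_def bool_subalgebra_def collapse_def)

lemma eval_annotated_bool_subalgebra:
  assumes "vars_annotated a \<subseteq> {y}"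
  shows "eval_annotated orth_MO2 (val_MO2 y) a \<in> bool_subalgebra"
    and "collapse (eval_annotated orth_MO2 (val_MO2 y) a) = eval_annotated orth_unit (\<lambda>_. UNIV) a"
  using assms by (cases a; simp add: eval_bool_subalgebra perp_bool_subalgebra)+

text \<open>\<open>collapse\<close> is monotone and commutes with \<open>perp\<close> on the
  subalgebra, so the same two formulas witness the claim.\<close>

lemma holds_MO2_imp_holds_classical:
  assumes "holds orth_MO2 (val_MO2 y) S" and vars: "vars_sequent S \<subseteq> {y}"
  shows "holds orth_unit (\<lambda>_. UNIV) S"
proof -
  obtain a b where ab: "a \<in> S" "b \<in> S"
    and sub: "perp orth_MO2 (eval_annotated orth_MO2 (val_MO2 y) a)
      \<subseteq> eval_annotated orth_MO2 (val_MO2 y) b"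
    using assms(1) by (auto simp: holds_def)
  have "vars_annotated a \<subseteq> {y}" "vars_annotated b \<subseteq> {y}"
    using ab vars by (auto simp: vars_sequent_def)
  note a = eval_annotated_bool_subalgebra[OF this(1)]
    and b = eval_annotated_bool_subalgebra[OF this(2)]
  have "collapse (perp orth_MO2 (eval_annotated orth_MO2 (val_MO2 y) a))
      \<subseteq> collapse (eval_annotated orth_MO2 (val_MO2 y) b)"
    using sub by (auto simp: collapse_def)
  then have "perp orth_unit (eval_annotated orth_unit (\<lambda>_. UNIV) a)
      \<subseteq> eval_annotated orth_unit (\<lambda>_. UNIV) b"
    by (simp only: a b perp_bool_subalgebra(2))
  with ab show ?thesis by (auto simp: holds_def)
qed

section \<open>Derivations and the counterexample\<close>

lemma at_most_one_empty [simp]: "at_most_one {}"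
  and at_most_one_singleton [simp]: "at_most_one {a}"
  by (simp_all add: at_most_one_def)

lemma cut_single:
  "Ax \<turnstile>\<^sub>o {Rgt \<phi>} \<Longrightarrow> Ax \<turnstile>\<^sub>o {Lft \<phi>, a} \<Longrightarrow> Ax \<turnstile>\<^sub>o {a}"
  using Cut[of "{}" "{a}" Ax \<phi>] by (simp add: insert_commute)

lemma And_le_left: "Ax \<turnstile>\<^sub>o {Lft (\<phi> and\<^sub>o \<psi>), Rgt \<phi>}"
  using LeftAnd[of "{Rgt \<phi>}" Ax \<phi> \<psi>] Hyp[of Ax \<phi>] by (simp add: insert_commute)

lemma And_le_right: "Ax \<turnstile>\<^sub>o {Lft (\<phi> and\<^sub>o \<psi>), Rgt \<psi>}"
proof -
  have "(\<phi> and\<^sub>o \<psi>) = (\<psi> and\<^sub>o \<phi>)"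
    by simp
  then show ?thesis
    using And_le_left[of Ax \<psi> \<phi>] by (simp only:)
qed

lemma Or_le:
  "Ax \<turnstile>\<^sub>o {Lft \<phi>, a} \<Longrightarrow> Ax \<turnstile>\<^sub>o {Lft \<psi>, a} \<Longrightarrow> Ax \<turnstile>\<^sub>o {Lft (\<phi> or\<^sub>o \<psi>), a}"
  using LeftOr[of "{a}" Ax \<phi> \<psi>] by (simp add: insert_commute)

text \<open>The inequality with \<psi> as a conjunct on the left fails in MO2. Here \<psi> is
  derived outright, so weakening by \<phi> and then \<open>LeftNot\<close> put its negation below
  \<phi>.\<close>

lemma disjunctive_syllogism:
  assumes "Ax \<turnstile>\<^sub>o {Rgt (\<phi> or\<^sub>o Neg \<psi>)}" and "Ax \<turnstile>\<^sub>o {Rgt \<psi>}"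
  shows "Ax \<turnstile>\<^sub>o {Rgt \<phi>}"
proof (rule cut_single[OF assms(1) Or_le])
  show "Ax \<turnstile>\<^sub>o {Lft \<phi>, Rgt \<phi>}" by (rule Hyp)
  have "Ax \<turnstile>\<^sub>o {Rgt \<phi>, Rgt \<psi>}"
    using Weaken[of "{Rgt \<psi>}" "{Rgt \<phi>}" Ax] assms(2) by (simp add: insert_commute)
  then show "Ax \<turnstile>\<^sub>o {Lft (Neg \<psi>), Rgt \<phi>}"
    using LeftNot[of "{Rgt \<phi>}" Ax \<psi>] by (simp add: insert_commute)
qed

lemma deducible_contradiction:
  assumes "Ax \<turnstile>\<^sub>o {Rgt \<phi>}" and "Ax \<turnstile>\<^sub>o {Rgt (Neg \<phi>)}"
  shows "Ax \<turnstile>\<^sub>o {}"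
  using Cut[of "{}" "{}" Ax "Neg \<phi>"] LeftNot[of "{}" Ax \<phi>] assms by simp

theorem theorem3:
  fixes x y z :: 'v and A B :: "'v sequent"
  assumes "distinct [x, y, z]"
    and "A = {Rgt ((Var z or\<^sub>o Neg (Var y)) and\<^sub>o (Neg (Var z) or\<^sub>o Neg (Var y)))}"
    and "B = {Rgt ((Var x and\<^sub>o Var y) or\<^sub>o (Neg (Var x) and\<^sub>o Var y))}"
  shows "inconsistent A B
    \<and> \<not> (\<exists>I. refutation_interpolant A B I)
    \<and> \<not> (\<forall>(A' :: 'v sequent) B'. is_sequent A' \<and> is_sequent B' \<and> inconsistent A' B'
            \<longrightarrow> (\<exists>I. refutation_interpolant A' B' I))"
proof -
  have A: "{A, B} \<turnstile>\<^sub>o {Rgt ((Var z or\<^sub>o Neg (Var y)) and\<^sub>o (Neg (Var z) or\<^sub>o Neg (Var y)))}"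
    and B: "{A, B} \<turnstile>\<^sub>o {Rgt ((Var x and\<^sub>o Var y) or\<^sub>o (Neg (Var x) and\<^sub>o Var y))}"
    using assms(2,3) by (auto intro: Axiom)
  \<comment> \<open>Both disjuncts of \<open>B\<close> lie below \<open>Var y\<close>.\<close>
  have y: "{A, B} \<turnstile>\<^sub>o {Rgt (Var y)}"
    by (rule cut_single[OF B Or_le[OF And_le_right And_le_right]])
  have "{A, B} \<turnstile>\<^sub>o {Rgt (Var z)}" "{A, B} \<turnstile>\<^sub>o {Rgt (Neg (Var z))}"
    by (rule disjunctive_syllogism[OF cut_single[OF A And_le_left] y],
        rule disjunctive_syllogism[OF cut_single[OF A And_le_right] y])
  then have inc: "inconsistent A B"
    unfolding inconsistent_def by (rule deducible_contradiction)
  have no_interpolant: "\<not> refutation_interpolant A B I" for I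
  proof
    assume "refutation_interpolant A B I"
    then have AI: "{A} \<turnstile>\<^sub>o I" and IB: "{I, B} \<turnstile>\<^sub>o {}"
      and "vars_sequent I \<subseteq> vars_sequent A \<inter> vars_sequent B"
      by (auto simp: refutation_interpolant_def inconsistent_def)
    then have vars: "vars_sequent I \<subseteq> {y}"
      using assms by (auto simp: vars_sequent_def)
    \<comment> \<open>Since \<open>z\<close> differs from \<open>y\<close>, its atom and the
      complementary atom both differ from the complement of the atom of \<open>y\<close>; each
      disjunction is therefore top.\<close>
    have "holds orth_MO2 (val_MO2 y) A"
      using assms(1,2) by (auto simp: val_MO2_def perp_MO2_singleton perp_MO2_two_atoms)
    then have "holds orth_MO2 (val_MO2 y) I"
      using MO2.deducible_sound[OF AI] by simp
    then have "holds orth_unit (\<lambda>_. UNIV) I"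
      using vars by (rule holds_MO2_imp_holds_classical)
    \<comment> \<open>With every variable true, the first disjunct of \<open>B\<close> is already
      top.\<close>
    moreover have "holds orth_unit (\<lambda>_. UNIV) B"
      using assms(3) by simp
    ultimately show False
      using classical.deducible_sound[OF IB] by auto
  qed
  have "is_sequent A" "is_sequent B"
    using assms(2,3) by (simp_all add: is_sequent_def)
  with inc no_interpolant show ?thesis by blast
qed

end
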